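(* Let $A\in\mathbb{R}^{n\times n}$ be symmetric positive semidefinite with largest eigenvalue $L$ and smallest eigenvalue $\alpha\ge0$, let $\mathbf{b}\in\mathbb{R}^n$, $\Delta>0$, $f(\mathbf{x})=\frac12\mathbf{x}^TA\mathbf{x}-\mathbf{b}^T\mathbf{x}$, $B=\{\mathbf{x}:\|\mathbf{x}\|\le\Delta\}$, $F=f+\mathrm{i}_B$ (with $\mathrm{i}_B=0$ on $B$ and $+\infty$ off $B$), and let $\mathbf{x}^*$ be a minimizer of $F$. Let $\{\mathbf{x}_k\}_{k\ge0}$ and the increasing subspaces $\{\mathcal{V}_k\}_{k\ge1}$ be generated by the trust-region Lanczos method described in the context, and let $\mathbf{y}_k=\operatorname{argmin}\{\|\mathbf{y}-\mathbf{x}^*\|^2:\mathbf{y}\in\mathcal{V}_k\}$ for $k\ge1$. Then for all $k\ge1$ the following hold: if $\alpha>0$, $$\|\mathbf{y}_{k+1}-\mathbf{x}^*\|^2+\frac{2(F(\mathbf{x}_{k+1})-F(\mathbf{x}^* ))}{\alpha}\le\left(1-\sqrt{\frac{\alpha}{L}}\right)\left(\|\mathbf{y}_k-\mathbf{x}^*\|^2+\frac{2(F(\mathbf{x}_k)-F(\mathbf{x}^* ))}{\alpha}\right),$$ and (for any $\alpha\ge0$) $$F(\mathbf{x}_k)-F(\mathbf{x}^* )\le\frac{2\left(L\|\mathbf{x}^*\|^2+F(\mathbf{0})-F(\mathbf{x}^* )\right)}{k(k+1)}.$$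
   Context: Trust-region Lanczos method (abstract version, exact arithmetic). Set $\mathbf{x}_0=\mathbf{0}$, $\mathbf{r}_0=\mathbf{b}$, $\mathbf{p}_0=\mathbf{r}_0$, and for $k\ge0$ let $\alpha_k=\frac{\mathbf{r}_k^T\mathbf{r}_k}{\mathbf{p}_k^TA\mathbf{p}_k}$, $\mathbf{r}_{k+1}=\mathbf{r}_k-\alpha_kA\mathbf{p}_k$, $\beta_k=\frac{\mathbf{r}_{k+1}^T\mathbf{r}_{k+1}}{\mathbf{r}_k^T\mathbf{r}_k}$, $\mathbf{p}_{k+1}=\beta_k\mathbf{p}_k+\mathbf{r}_{k+1}$ (the scalars $\alpha_k$ are not to be confused with the eigenvalue $\alpha$). Let $\mathcal{V}_k=\mathrm{span}\{\mathbf{p}_0,\ldots,\mathbf{p}_{k-1}\}$ for $k\ge1$, and let $\mathbf{x}_k\in\operatorname{argmin}\{\frac12\mathbf{x}^TA\mathbf{x}-\mathbf{b}^T\mathbf{x}:\mathbf{x}\in\mathcal{V}_k,\ \|\mathbf{x}\|\le\Delta\}$. The iteration is considered only as long as it does not break down, i.e. as long as the divisions above are defined and $\mathbf{r}_k\ne\mathbf{0}$; statements about index $k$ (or $k+1$) are for those indices for which the iterates are generated. *)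

theory Defs
  imports "HOL-Analysis.Analysis"
begin

definition psd_matrix :: "real^'n^'n \<Rightarrow> bool" where
  "psd_matrix A \<longleftrightarrow> transpose A = A \<and> (\<forall>v. 0 \<le> v \<bullet> (A *v v))"

definition eigenvalue :: "real^'n^'n \<Rightarrow> real \<Rightarrow> bool" where
  "eigenvalue A \<mu> \<longleftrightarrow> (\<exists>v. v \<noteq> 0 \<and> A *v v = \<mu> *\<^sub>R v)"

definition largest_eigenvalue :: "real^'n^'n \<Rightarrow> real \<Rightarrow> bool" where
  "largest_eigenvalue A L \<longleftrightarrow> eigenvalue A L \<and> (\<forall>\<mu>. eigenvalue A \<mu> \<longrightarrow> \<mu> \<le> L)"

definition smallest_eigenvalue :: "real^'n^'n \<Rightarrow> real \<Rightarrow> bool" where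
  "smallest_eigenvalue A \<alpha> \<longleftrightarrow> eigenvalue A \<alpha> \<and> (\<forall>\<mu>. eigenvalue A \<mu> \<longrightarrow> \<alpha> \<le> \<mu>)"

definition quad :: "real^'n^'n \<Rightarrow> real^'n \<Rightarrow> real^'n \<Rightarrow> real" where
  "quad A b v = (1/2) * (v \<bullet> (A *v v)) - b \<bullet> v"

definition indicator_fun :: "'a set \<Rightarrow> 'a \<Rightarrow> ereal" where
  "indicator_fun S v = (if v \<in> S then 0 else \<infinity>)"

definition tr_objective :: "real^'n^'n \<Rightarrow> real^'n \<Rightarrow> real \<Rightarrow> real^'n \<Rightarrow> ereal" where
  "tr_objective A b \<Delta> v = ereal (quad A b v) + indicator_fun (cball 0 \<Delta>) v"

(* These sequences are total because division by zero yields zero; their values are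
   meaningful only in the range delimited by lanczos_generated below. *)
function lanczos_res :: "real^'n^'n \<Rightarrow> real^'n \<Rightarrow> nat \<Rightarrow> real^'n"
  and lanczos_dir :: "real^'n^'n \<Rightarrow> real^'n \<Rightarrow> nat \<Rightarrow> real^'n"
  and lanczos_alpha :: "real^'n^'n \<Rightarrow> real^'n \<Rightarrow> nat \<Rightarrow> real"
  and lanczos_beta :: "real^'n^'n \<Rightarrow> real^'n \<Rightarrow> nat \<Rightarrow> real"
where
  "lanczos_res A b 0 = b"
| "lanczos_res A b (Suc k) =
     lanczos_res A b k - lanczos_alpha A b k *\<^sub>R (A *v lanczos_dir A b k)"
| "lanczos_dir A b 0 = lanczos_res A b 0"
| "lanczos_dir A b (Suc k) =
     lanczos_beta A b k *\<^sub>R lanczos_dir A b k + lanczos_res A b (Suc k)"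
| "lanczos_alpha A b k =
     (lanczos_res A b k \<bullet> lanczos_res A b k) / (lanczos_dir A b k \<bullet> (A *v lanczos_dir A b k))"
| "lanczos_beta A b k =
     (lanczos_res A b (Suc k) \<bullet> lanczos_res A b (Suc k)) / (lanczos_res A b k \<bullet> lanczos_res A b k)"
  by pat_completeness auto
termination
  by (relation "Wellfounded.measure (\<lambda>s. case s of
        Inl (Inl (A, b, k)) \<Rightarrow> 4 * k
      | Inl (Inr (A, b, k)) \<Rightarrow> 4 * k + 2
      | Inr (Inl (A, b, k)) \<Rightarrow> 4 * k + 3
      | Inr (Inr (A, b, k)) \<Rightarrow> 4 * k + 5)") auto

(* The last two equations are unconditional and would unfold without being asked. *)
declare lanczos_alpha.simps [simp del] lanczos_beta.simps [simp del]

definition lanczos_space :: "real^'n^'n \<Rightarrow> real^'n \<Rightarrow> nat \<Rightarrow> (real^'n) set" where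
  "lanczos_space A b k = span (lanczos_dir A b ` {..<k})"

(* No breakdown in producing the directions 0, ..., k - 1 that span the k-th subspace:
   their residuals are nonzero, and so are the denominators of the step lengths
   0, ..., k - 2 needed to reach direction k - 1.  The step length k - 1 is not needed. *)
definition lanczos_generated :: "real^'n^'n \<Rightarrow> real^'n \<Rightarrow> nat \<Rightarrow> bool" where
  "lanczos_generated A b k \<longleftrightarrow>
     (\<forall>j<k. lanczos_res A b j \<noteq> 0) \<and>
     (\<forall>j. Suc j < k \<longrightarrow> lanczos_dir A b j \<bullet> (A *v lanczos_dir A b j) \<noteq> 0)"

definition trust_region_lanczos ::
    "real^'n^'n \<Rightarrow> real^'n \<Rightarrow> real \<Rightarrow> (nat \<Rightarrow> real^'n) \<Rightarrow> bool" where
  "trust_region_lanczos A b \<Delta> x \<longleftrightarrow>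
     x 0 = 0 \<and>
     (\<forall>k\<ge>1. lanczos_generated A b k \<longrightarrow>
        is_arg_min (quad A b) (\<lambda>v. v \<in> lanczos_space A b k \<and> norm v \<le> \<Delta>) (x k))"

end

theory Submission
  imports Defs
begin

text \<open>
  Neither iterate has to be followed explicitly: \<open>x (k + 1)\<close> and \<open>y (k + 1)\<close> are optimal
  in the space \<open>V (k + 1)\<close>, so they are at least as good as the two sequences of an
  accelerated proximal gradient method started from \<open>x k\<close> and \<open>y k\<close>, provided that
  one step of that method stays in \<open>V (k + 1)\<close>.  It does: \<open>V k\<close> behaves like a Krylov space,
  so a gradient at a point of \<open>V k\<close> lies in \<open>V (k + 1)\<close>, and the projection onto the ball
  is a rescaling and therefore preserves subspaces.  The usual one-step potential estimates of the
  accelerated method, with momentum \<open>sqrt (\<alpha> / L)\<close> in the strongly convex case and with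
  weights \<open>k (k + 1) / 4\<close> in general, then give both bounds.
\<close>

section \<open>Rayleigh quotients\<close>

lemma inner_symmetric_matrix:
  fixes A :: "real^'n^'n"
  assumes "transpose A = A"
  shows "u \<bullet> (A *v v) = v \<bullet> (A *v u)"
proof -
  have "u \<bullet> (A *v v) = (transpose A *v u) \<bullet> v"
    by (simp add: dot_lmul_matrix)
  then show ?thesis
    by (simp only: assms inner_commute)
qed

text \<open>The form at \<open>v - t u\<close>, with \<open>u = A *v v\<close>, is a nonnegative
  quadratic polynomial in \<open>t\<close> without constant term, so its linear coefficient, a
  multiple of \<open>u \<bullet> u\<close>, must vanish.\<close>

lemma psd_matrix_kernel:
  fixes A :: "real^'n^'n"
  assumes psd: "psd_matrix A" and z: "v \<bullet> (A *v v) = 0"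
  shows "A *v v = 0"
proof -
  have sym: "transpose A = A" and pos: "\<And>u. 0 \<le> u \<bullet> (A *v u)"
    using psd by (auto simp: psd_matrix_def)
  define u where "u = A *v v"
  define c where "c = u \<bullet> (A *v u)"
  have c: "c \<ge> 0"
    using pos by (simp add: c_def)
  have "v \<bullet> (A *v u) = u \<bullet> u"
    using inner_symmetric_matrix[OF sym, of v u] by (simp add: u_def)
  then have eq: "(v - t *\<^sub>R u) \<bullet> (A *v (v - t *\<^sub>R u)) = - 2 * t * (u \<bullet> u) + t\<^sup>2 * c" for t
    using z by (simp add: matrix_vector_mult_diff_distrib matrix_vector_mult_scaleR
        inner_diff_left inner_diff_right c_def algebra_simps power2_eq_square flip: u_def)
  have "0 \<le> - 2 * t * (u \<bullet> u) + t\<^sup>2 * c" for t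
    using pos eq by metis
  \<comment> \<open>At \<open>t = s\<close> the polynomial equals \<open>- s^2 (2 + c)\<close>; the
    summand \<open>1\<close> keeps the denominator positive when \<open>c = 0\<close>.\<close>
  moreover define s where "s = (u \<bullet> u) / (1 + c)"
  ultimately have "0 \<le> - 2 * s * (u \<bullet> u) + s\<^sup>2 * c"
    by blast
  moreover have uu: "u \<bullet> u = s * (1 + c)"
    using c by (simp add: s_def)
  ultimately have "s\<^sup>2 * (2 + c) \<le> 0"
    by (simp add: algebra_simps power2_eq_square)
  with c have "s = 0"
    by (simp add: mult_le_0_iff)
  with uu have "u \<bullet> u = 0"
    by simp
  then show ?thesis
    by (simp add: u_def)
qed

text \<open>Compactness of the unit sphere gives a maximizer \<open>v\<close> of the form, with
  value \<open>M\<close>. Then \<open>mat M - A\<close> is positive semidefinite and its form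
  vanishes at \<open>v\<close>, so \<open>v\<close> lies in its kernel and is an eigenvector of
  \<open>A\<close>.\<close>

lemma exists_eigenvalue_above_rayleigh:
  fixes A :: "real^'n^'n"
  assumes sym: "transpose A = A"
  shows "\<exists>M. eigenvalue A M \<and> (\<forall>v. v \<bullet> (A *v v) \<le> M * (norm v)\<^sup>2)"
proof -
  have "sphere (0::real^'n) 1 \<noteq> {}"
    by simp
  moreover have "continuous_on (sphere 0 1) (\<lambda>v. v \<bullet> (A *v v))"
    by (intro continuous_intros matrix_vector_mult_linear_continuous_on)
  ultimately obtain v where v: "norm v = 1"
    and max: "\<And>u. norm u = 1 \<Longrightarrow> u \<bullet> (A *v u) \<le> v \<bullet> (A *v v)"
    using continuous_attains_sup[of "sphere 0 1" "\<lambda>v. v \<bullet> (A *v v)"] by auto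
  define M where "M = v \<bullet> (A *v v)"
  have bound: "u \<bullet> (A *v u) \<le> M * (norm u)\<^sup>2" for u
  proof (cases "u = 0")
    case False
    have "(u /\<^sub>R norm u) \<bullet> (A *v (u /\<^sub>R norm u)) \<le> M"
      unfolding M_def using False by (intro max) simp
    then show ?thesis
      using False by (simp add: matrix_vector_mult_scaleR field_simps power2_eq_square)
  qed simp
  have "mat M *v u = M *\<^sub>R u" for u :: "real^'n"
    by (simp add: matrix_vector_mult_def mat_def vec_eq_iff if_distrib if_distribR cong: if_cong)
  then have shifted: "(mat M - A) *v u = M *\<^sub>R u - A *v u" for u
    by (simp add: matrix_vector_mult_diff_rdistrib)
  have "psd_matrix (mat M - A)"
    using sym bound
    by (auto simp: psd_matrix_def shifted inner_diff_right power2_norm_eq_inner)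
       (auto simp: transpose_def mat_def vec_eq_iff)
  moreover have "v \<bullet> ((mat M - A) *v v) = 0"
    using v by (simp add: shifted inner_diff_right norm_eq_1 flip: M_def)
  ultimately have "(mat M - A) *v v = 0"
    by (rule psd_matrix_kernel)
  then have "eigenvalue A M"
    using v unfolding eigenvalue_def shifted by (intro exI[of _ v]) auto
  with bound show ?thesis
    by blast
qed

lemma rayleigh_le_largest_eigenvalue:
  fixes A :: "real^'n^'n"
  assumes "transpose A = A" and "largest_eigenvalue A L"
  shows "v \<bullet> (A *v v) \<le> L * (norm v)\<^sup>2"
proof -
  obtain M where "eigenvalue A M" and M: "v \<bullet> (A *v v) \<le> M * (norm v)\<^sup>2"
    using exists_eigenvalue_above_rayleigh[OF assms(1)] by blast
  then have "M * (norm v)\<^sup>2 \<le> L * (norm v)\<^sup>2"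
    using assms(2) by (intro mult_right_mono) (auto simp: largest_eigenvalue_def)
  with M show ?thesis
    by linarith
qed

text \<open>Follows from the maximal Rayleigh quotient of \<open>- A\<close>, since negation maps
  eigenvalues of \<open>- A\<close> to eigenvalues of \<open>A\<close>.\<close>

lemma rayleigh_ge_smallest_eigenvalue:
  fixes A :: "real^'n^'n"
  assumes "transpose A = A" and "smallest_eigenvalue A \<alpha>"
  shows "\<alpha> * (norm v)\<^sup>2 \<le> v \<bullet> (A *v v)"
proof -
  have neg: "(- A) *v u = - (A *v u)" for u
    by (simp add: vec_eq_iff matrix_vector_mult_def sum_negf)
  have eig: "eigenvalue A (- \<mu>)" if ev: "eigenvalue (- A) \<mu>" for \<mu>
  proof -
    obtain u where "u \<noteq> 0" "- (A *v u) = \<mu> *\<^sub>R u"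
      using ev unfolding eigenvalue_def neg by blast
    then have "u \<noteq> 0 \<and> A *v u = (- \<mu>) *\<^sub>R u"
      by (metis minus_equation_iff scaleR_minus_left)
    then show ?thesis
      unfolding eigenvalue_def by blast
  qed
  have "transpose (- A) = - A"
    using assms(1) by (simp add: transpose_def vec_eq_iff)
  then obtain M where M: "eigenvalue (- A) M" and le: "v \<bullet> ((- A) *v v) \<le> M * (norm v)\<^sup>2"
    using exists_eigenvalue_above_rayleigh by blast
  from eig[OF M] have "\<alpha> \<le> - M"
    using assms(2) by (auto simp: smallest_eigenvalue_def)
  then have "\<alpha> * (norm v)\<^sup>2 \<le> (- M) * (norm v)\<^sup>2"
    by (rule mult_right_mono) simp
  then show ?thesis
    using le by (simp add: neg)
qed

section \<open>The projected gradient step\<close>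

text \<open>The variational inequality characterizes the metric projection onto the ball; for
  \<open>v\<close> outside, it is Cauchy-Schwarz with \<open>c = \<Delta> / norm v\<close>. Being a
  multiple of \<open>v\<close>, the projection stays in every subspace containing
  \<open>v\<close>.\<close>

lemma cball_projection_is_rescaling:
  fixes v :: "'a::real_inner"
  assumes "\<Delta> > 0"
  shows "\<exists>c. norm (c *\<^sub>R v) \<le> \<Delta> \<and>
    (\<forall>u. norm u \<le> \<Delta> \<longrightarrow> (v - c *\<^sub>R v) \<bullet> (u - c *\<^sub>R v) \<le> 0)"
proof (cases "norm v \<le> \<Delta>")
  case True
  then show ?thesis
    by (intro exI[of _ 1]) simp
next
  case False
  define c where "c = \<Delta> / norm v"
  have v: "norm v > \<Delta>" "norm v > 0"
    using False assms by linarith+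
  have c: "0 \<le> c" "c \<le> 1" "c * norm v = \<Delta>"
    using v assms by (auto simp: c_def)
  have "(v - c *\<^sub>R v) \<bullet> (u - c *\<^sub>R v) \<le> 0" if u: "norm u \<le> \<Delta>" for u
  proof -
    have "v \<bullet> u \<le> norm v * norm u"
      by (rule norm_cauchy_schwarz)
    also have "\<dots> \<le> norm v * \<Delta>"
      using u by (intro mult_left_mono) auto
    also have "\<dots> = c * (v \<bullet> v)"
      using c(3) by (metis mult.assoc mult.commute power2_eq_square power2_norm_eq_inner)
    finally have "v \<bullet> (u - c *\<^sub>R v) \<le> 0"
      by (simp add: inner_diff_right)
    then have "(1 - c) * (v \<bullet> (u - c *\<^sub>R v)) \<le> 0"
      using c(2) by (simp add: mult_nonneg_nonpos)
    moreover have "v - c *\<^sub>R v = (1 - c) *\<^sub>R v"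
      by (simp add: scaleR_left_diff_distrib)
    ultimately show ?thesis
      by simp
  qed
  with c show ?thesis
    by (intro exI[of _ c]) auto
qed

lemma quad_expansion:
  fixes A :: "real^'n^'n"
  assumes "transpose A = A"
  shows "quad A b u = quad A b w + (A *v w - b) \<bullet> (u - w) + (1/2) * ((u - w) \<bullet> (A *v (u - w)))"
proof -
  define h where "h = u - w"
  have u: "u = w + h"
    by (simp add: h_def)
  have "h \<bullet> (A *v w) = w \<bullet> (A *v h)"
    by (rule inner_symmetric_matrix[OF assms])
  then have "quad A b (w + h) = quad A b w + (A *v w - b) \<bullet> h + (1/2) * (h \<bullet> (A *v h))"
    by (simp add: quad_def matrix_vector_right_distrib inner_add_left inner_add_right
        inner_diff_left inner_commute[of "A *v w" h] algebra_simps)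
  then show ?thesis
    by (simp only: u add_diff_cancel_left')
qed

text \<open>\<open>G\<close> is the gradient mapping at \<open>w\<close>; note that \<open>w\<close> itself may lie outside the ball.\<close>

lemma projected_gradient_step:
  fixes A :: "real^'n^'n"
  assumes sym: "transpose A = A"
    and upper: "\<And>v. v \<bullet> (A *v v) \<le> L * (norm v)\<^sup>2"
    and lower: "\<And>v. \<alpha> * (norm v)\<^sup>2 \<le> v \<bullet> (A *v v)"
    and L: "L > 0" and \<Delta>: "\<Delta> > 0"
    and V: "subspace V" and wV: "w \<in> V" and gV: "A *v w - b \<in> V"
  shows "\<exists>xp G. xp \<in> V \<and> G \<in> V \<and> norm xp \<le> \<Delta> \<and>
    (\<forall>u. norm u \<le> \<Delta> \<longrightarrow>
      quad A b xp + G \<bullet> (u - w) + (norm G)\<^sup>2 / (2 * L) + \<alpha> / 2 * (norm (u - w))\<^sup>2 \<le> quad A b u)"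
proof -
  define g where "g = A *v w - b"
  define v where "v = w - g /\<^sub>R L"
  obtain c where c: "norm (c *\<^sub>R v) \<le> \<Delta>"
    and vi: "\<And>u. norm u \<le> \<Delta> \<Longrightarrow> (v - c *\<^sub>R v) \<bullet> (u - c *\<^sub>R v) \<le> 0"
    using cball_projection_is_rescaling[OF \<Delta>] by blast
  define xp where "xp = c *\<^sub>R v"
  define G where "G = L *\<^sub>R (w - xp)"
  have vV: "v \<in> V"
    unfolding v_def using V wV gV by (auto simp: g_def intro: subspace_diff subspace_scale)
  then have xpV: "xp \<in> V" and GV: "G \<in> V"
    unfolding xp_def G_def using V wV by (auto intro: subspace_diff subspace_scale)
  have main: "quad A b xp + G \<bullet> (u - w) + (norm G)\<^sup>2 / (2 * L) + \<alpha> / 2 * (norm (u - w))\<^sup>2 \<le> quad A b u"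
    if u: "norm u \<le> \<Delta>" for u
  proof -
    \<comment> \<open>The claim adds three facts: the lower curvature bound at \<open>u\<close>, the
      upper curvature bound at \<open>xp\<close>, and the variational inequality of the projection
      scaled by \<open>L\<close>.\<close>
    have 1: "quad A b w + g \<bullet> (u - w) + \<alpha> / 2 * (norm (u - w))\<^sup>2 \<le> quad A b u"
      using lower[of "u - w"] quad_expansion[OF sym, of b u w] by (simp add: g_def)
    have 2: "quad A b xp \<le> quad A b w + g \<bullet> (xp - w) + L / 2 * (norm (xp - w))\<^sup>2"
      using upper[of "xp - w"] quad_expansion[OF sym, of b xp w] by (simp add: g_def)
    have "L *\<^sub>R (v - xp) = G - g"
      using L by (simp add: G_def v_def algebra_simps)
    moreover have "L * ((v - xp) \<bullet> (u - xp)) \<le> 0"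
      using vi[OF u] L by (simp add: xp_def mult_nonneg_nonpos)
    ultimately have 3: "(G - g) \<bullet> (u - xp) \<le> 0"
      by (metis inner_scaleR_left)
    have xpw: "xp - w = (- 1 / L) *\<^sub>R G"
      using L by (simp add: G_def)
    have 4: "(norm (xp - w))\<^sup>2 = (norm G)\<^sup>2 / L\<^sup>2"
      using L by (simp add: xpw power_divide)
    have 5: "L / 2 * ((norm G)\<^sup>2 / L\<^sup>2) = (norm G)\<^sup>2 / (2 * L)"
      using L by (simp add: power2_eq_square)
    have 6: "G \<bullet> (xp - w) = - 2 * ((norm G)\<^sup>2 / (2 * L))"
      using L by (simp add: xpw flip: power2_norm_eq_inner)
    have 7: "(G - g) \<bullet> (u - xp) = G \<bullet> (u - w) - G \<bullet> (xp - w) - g \<bullet> (u - w) + g \<bullet> (xp - w)"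
      by (simp add: inner_diff_left inner_diff_right)
    show ?thesis
      using 1 2 3 6 7 unfolding 4 5 by linarith
  qed
  show ?thesis
    using xpV GV c main unfolding xp_def by blast
qed

section \<open>One step of the potential\<close>

text \<open>Here \<open>q = sqrt (\<alpha> / L)\<close>. Weighting \<open>hx\<close> by
  \<open>1 - q\<close> and \<open>hs\<close> by \<open>q\<close> produces exactly the inner products
  with \<open>G\<close> that occur in the expanded square, with opposite sign.\<close>

lemma strongly_convex_potential_step:
  fixes x y w G xs :: "'a::real_inner"
  assumes q: "0 < q" "q \<le> 1" and \<alpha>: "\<alpha> > 0" and L: "q\<^sup>2 * L = \<alpha>"
    and w: "w = (1 / (1 + q)) *\<^sub>R (x + q *\<^sub>R y)"
    and hx: "fp + G \<bullet> (x - w) + (norm G)\<^sup>2 / (2 * L) + \<alpha> / 2 * (norm (x - w))\<^sup>2 \<le> fx"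
    and hs: "fp + G \<bullet> (xs - w) + (norm G)\<^sup>2 / (2 * L) + \<alpha> / 2 * (norm (xs - w))\<^sup>2 \<le> fs"
  shows "(norm ((1 - q) *\<^sub>R y + q *\<^sub>R w - (q / \<alpha>) *\<^sub>R G - xs))\<^sup>2 + 2 * (fp - fs) / \<alpha>
    \<le> (1 - q) * ((norm (y - xs))\<^sup>2 + 2 * (fx - fs) / \<alpha>)"
proof -
  define a d where "a = y - xs" and "d = w - xs"
  define g where "g = (norm G)\<^sup>2"
  have L0: "L > 0"
    using L \<alpha> q by (metis zero_less_mult_pos zero_less_power)
  have "(1 + q) *\<^sub>R w = x + q *\<^sub>R y"
    using q by (simp add: w)
  then have "x = w + q *\<^sub>R w - q *\<^sub>R y"
    by (simp add: scaleR_left_distrib)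
  \<comment> \<open>The momentum weights of \<open>w\<close> are chosen for this relation, which
    expresses \<open>x\<close> through \<open>y\<close> and \<open>w\<close>.\<close>
  then have xw: "x - w = q *\<^sub>R (d - a)"
    by (simp add: a_def d_def algebra_simps)
  have sw: "xs - w = - d"
    by (simp add: d_def)
  \<comment> \<open>The first three terms are the identity for the squared norm of a convex
    combination.\<close>
  have square: "(norm ((1 - q) *\<^sub>R a + q *\<^sub>R d - s *\<^sub>R G))\<^sup>2
      = (1 - q) * (norm a)\<^sup>2 + q * (norm d)\<^sup>2 - q * (1 - q) * (norm (a - d))\<^sup>2
        - 2 * s * ((1 - q) * (G \<bullet> a) + q * (G \<bullet> d)) + s\<^sup>2 * g" for s
    unfolding g_def power2_norm_eq_inner
    by (simp add: inner_diff_left inner_diff_right inner_add_left inner_add_right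
        inner_commute[of a G] inner_commute[of d G] inner_commute[of d a]
        algebra_simps power2_eq_square)
  have eq: "(1 - q) *\<^sub>R y + q *\<^sub>R w - (q / \<alpha>) *\<^sub>R G - xs
      = (1 - q) *\<^sub>R a + q *\<^sub>R d - (q / \<alpha>) *\<^sub>R G"
    by (simp add: a_def d_def algebra_simps)
  \<comment> \<open>With the step length \<open>q / \<alpha>\<close>, the squared gradient term of
    the square cancels against the gain \<open>g / (2 * L)\<close> of the descent
    inequalities.\<close>
  have coeff: "(q / \<alpha>)\<^sup>2 * g = g / (\<alpha> * L)"
    using q L[symmetric] L0 by (simp add: field_simps power2_eq_square)
  note z = square[of "q / \<alpha>", unfolded coeff, folded eq]
  have hx': "fp + q * (G \<bullet> d - G \<bullet> a) + g / (2 * L) \<le> fx"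
  proof -
    have "0 \<le> \<alpha> / 2 * (norm (x - w))\<^sup>2"
      using \<alpha> by simp
    then show ?thesis
      using hx by (simp add: xw g_def inner_diff_right)
  qed
  have hs': "fp - G \<bullet> d + g / (2 * L) + \<alpha> / 2 * (norm d)\<^sup>2 \<le> fs"
    using hs by (simp add: sw g_def)
  have "(1 - q) * (fp + q * (G \<bullet> d - G \<bullet> a) + g / (2 * L))
      + q * (fp - G \<bullet> d + g / (2 * L) + \<alpha> / 2 * (norm d)\<^sup>2) \<le> (1 - q) * fx + q * fs"
    using q hx' hs' by (intro add_mono mult_left_mono) auto
  then have "fp - fs \<le> (1 - q) * (fx - fs) + q * ((1 - q) * (G \<bullet> a) + q * (G \<bullet> d))
      - g / (2 * L) - q * (\<alpha> / 2 * (norm d)\<^sup>2)"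
    by (simp only: ring_distribs mult_1_left)
  then have "2 / \<alpha> * (fp - fs) \<le> 2 / \<alpha> * ((1 - q) * (fx - fs)
      + q * ((1 - q) * (G \<bullet> a) + q * (G \<bullet> d)) - g / (2 * L) - q * (\<alpha> / 2 * (norm d)\<^sup>2))"
    using \<alpha> by (intro mult_left_mono) auto
  also have "\<dots> = (1 - q) * (2 * (fx - fs) / \<alpha>)
      + 2 * (q / \<alpha>) * ((1 - q) * (G \<bullet> a) + q * (G \<bullet> d)) - g / (\<alpha> * L) - q * (norm d)\<^sup>2"
    using \<alpha> L0 by (simp add: field_simps)
  finally have "2 * (fp - fs) / \<alpha> \<le> \<dots>"
    by simp
  moreover have "0 \<le> q * (1 - q) * (norm (a - d))\<^sup>2"
    using q by simp
  ultimately show ?thesis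
    unfolding z by (simp add: a_def distrib_left)
qed

text \<open>In the sum of \<open>hx\<close> and \<open>hs\<close> with weights \<open>c\<close> and
  \<open>a\<close>, the choice of \<open>w\<close> collapses the inner products to
  \<open>- a * (G \<bullet> (y - xs))\<close>, the cross term of the expanded square.\<close>

lemma convex_potential_step:
  fixes x y w G xs :: "'a::real_inner"
  assumes L: "L > 0" and c: "c \<ge> 0" and a: "a > 0" "a\<^sup>2 \<le> c + a"
    and w: "w = (1 / (c + a)) *\<^sub>R (c *\<^sub>R x + a *\<^sub>R y)"
    and hx: "fp + G \<bullet> (x - w) + (norm G)\<^sup>2 / (2 * L) \<le> fx"
    and hs: "fp + G \<bullet> (xs - w) + (norm G)\<^sup>2 / (2 * L) \<le> fs"
  shows "(c + a) * (fp - fs) + L / 2 * (norm (y - (a / L) *\<^sub>R G - xs))\<^sup>2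
    \<le> c * (fx - fs) + L / 2 * (norm (y - xs))\<^sup>2"
proof -
  define g where "g = (norm G)\<^sup>2 / (2 * L)"
  have "(c + a) *\<^sub>R w = c *\<^sub>R x + a *\<^sub>R y"
    using c a by (simp add: w)
  then have "G \<bullet> ((c + a) *\<^sub>R w) = G \<bullet> (c *\<^sub>R x + a *\<^sub>R y)"
    by simp
  then have Gw: "(c + a) * (G \<bullet> w) = c * (G \<bullet> x) + a * (G \<bullet> y)"
    by (simp add: inner_add_right)
  define h where "h = y - xs"
  have yh: "y - (a / L) *\<^sub>R G - xs = h - (a / L) *\<^sub>R G"
    by (simp add: h_def)
  have z: "L / 2 * (norm (y - (a / L) *\<^sub>R G - xs))\<^sup>2
      = L / 2 * (norm (y - xs))\<^sup>2 - a * (G \<bullet> (y - xs)) + a\<^sup>2 * g"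
    unfolding yh h_def[symmetric] g_def power2_norm_eq_inner using L
    by (simp add: inner_diff_left inner_diff_right inner_commute[of h G] field_simps power2_eq_square)
  have "c * (fp + G \<bullet> (x - w) + g) + a * (fp + G \<bullet> (xs - w) + g) \<le> c * fx + a * fs"
    using c a hx hs by (intro add_mono mult_left_mono) (auto simp: g_def)
  \<comment> \<open>The growth condition \<open>a^2 \<le> c + a\<close> lets the gain of the descent
    inequalities pay for the squared gradient step.\<close>
  moreover have "a\<^sup>2 * g \<le> (c + a) * g"
    using a L by (intro mult_right_mono) (auto simp: g_def)
  ultimately show ?thesis
    unfolding z using Gw by (simp add: inner_diff_right algebra_simps)
qed

section \<open>Lanczos spaces\<close>

lemma lanczos_generated_Suc: "lanczos_generated A b (Suc k) \<Longrightarrow> lanczos_generated A b k"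
  by (auto simp: lanczos_generated_def)

lemma subspace_lanczos_space: "subspace (lanczos_space A b k)"
  by (simp add: lanczos_space_def)

lemma lanczos_space_mono: "j \<le> k \<Longrightarrow> lanczos_space A b j \<subseteq> lanczos_space A b k"
  unfolding lanczos_space_def by (intro span_mono image_mono) auto

lemma lanczos_dir_in_space: "j < k \<Longrightarrow> lanczos_dir A b j \<in> lanczos_space A b k"
  unfolding lanczos_space_def by (intro span_base) auto

text \<open>The direction recurrence, solved for the residual, involves only directions with indices
  \<open>j\<close> and \<open>j - 1\<close>.\<close>

lemma lanczos_res_in_space:
  assumes "j < k" shows "lanczos_res A b j \<in> lanczos_space A b k"
proof (cases j)
  case 0
  then show ?thesis
    using lanczos_dir_in_space[OF assms, of A b] by simp
next
  case (Suc i)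
  have "lanczos_res A b j = lanczos_dir A b j - lanczos_beta A b i *\<^sub>R lanczos_dir A b i"
    by (simp add: Suc)
  also have "\<dots> \<in> lanczos_space A b k"
    using assms Suc
    by (intro subspace_diff subspace_scale subspace_lanczos_space lanczos_dir_in_space) auto
  finally show ?thesis .
qed

text \<open>The Krylov property: the residual recurrence, solved for \<open>A\<close> times
  direction \<open>j\<close>, gives a multiple of the difference of residuals \<open>j\<close> and
  \<open>j + 1\<close>, and \<open>j < k\<close> puts both in the next space.\<close>

lemma matrix_image_lanczos_space:
  fixes A :: "real^'n^'n"
  assumes gen: "lanczos_generated A b (Suc k)" and w: "w \<in> lanczos_space A b k"
  shows "A *v w \<in> lanczos_space A b (Suc k)"
proof -
  have dir: "A *v lanczos_dir A b j \<in> lanczos_space A b (Suc k)" if j: "j < k" for j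
  proof -
    \<comment> \<open>Generation up to \<open>Suc k\<close> covers the residuals up to
      \<open>k\<close> and the denominators below \<open>k\<close>, hence both parts of this
      quotient.\<close>
    have "lanczos_alpha A b j \<noteq> 0"
      using gen j by (auto simp: lanczos_generated_def lanczos_alpha.simps)
    then have "A *v lanczos_dir A b j =
        (1 / lanczos_alpha A b j) *\<^sub>R (lanczos_res A b j - lanczos_res A b (Suc j))"
      by simp
    also have "\<dots> \<in> lanczos_space A b (Suc k)"
      using j by (intro subspace_diff subspace_scale subspace_lanczos_space lanczos_res_in_space) auto
    finally show ?thesis .
  qed
  have "subspace {v. A *v v \<in> lanczos_space A b (Suc k)}"
    using subspace_lanczos_space[of A b "Suc k"]
    by (auto simp: subspace_def matrix_vector_right_distrib matrix_vector_mult_scaleR)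
  then have "lanczos_space A b k \<subseteq> {v. A *v v \<in> lanczos_space A b (Suc k)}"
    unfolding lanczos_space_def[of A b k] using dir by (intro span_minimal) auto
  with w show ?thesis
    by auto
qed

lemma gradient_in_lanczos_space:
  fixes A :: "real^'n^'n"
  assumes "lanczos_generated A b (Suc k)" and "w \<in> lanczos_space A b k"
  shows "A *v w - b \<in> lanczos_space A b (Suc k)"
  using matrix_image_lanczos_space[OF assms] lanczos_res_in_space[of 0 "Suc k" A b]
  by (intro subspace_diff subspace_lanczos_space) auto

section \<open>Optimality of the iterates and the two rates for real values\<close>

lemma tr_objective_in_ball: "norm v \<le> \<Delta> \<Longrightarrow> tr_objective A b \<Delta> v = ereal (quad A b v)"
  by (simp add: tr_objective_def indicator_fun_def)

text \<open>\<open>is_arg_min\<close> only excludes strictly smaller values; in a linear order this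
  becomes a comparison.\<close>

lemma is_arg_min_le:
  fixes f :: "'a \<Rightarrow> 'b::linorder"
  shows "is_arg_min f P x \<Longrightarrow> P v \<Longrightarrow> f x \<le> f v"
  by (auto simp: is_arg_min_def not_less)

text \<open>The curvature constants enter as Rayleigh bounds rather than as eigenvalues, so
  \<open>L\<close> may be any positive upper bound, including one above the largest
  eigenvalue.\<close>

locale lanczos_run =
  fixes A :: "real^'n^'n" and b xstar :: "real^'n" and x y :: "nat \<Rightarrow> real^'n" and \<alpha> L \<Delta> :: real
  assumes sym: "transpose A = A"
    and upper: "\<And>v. v \<bullet> (A *v v) \<le> L * (norm v)\<^sup>2"
    and lower: "\<And>v. \<alpha> * (norm v)\<^sup>2 \<le> v \<bullet> (A *v v)"
    and \<alpha>_nonneg: "\<alpha> \<ge> 0" and L_pos: "L > 0" and \<Delta>_pos: "\<Delta> > 0"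
    and xstar_ball: "norm xstar \<le> \<Delta>"
    and run: "trust_region_lanczos A b \<Delta> x"
    and proj: "\<And>k. k \<ge> 1 \<Longrightarrow> lanczos_generated A b k \<Longrightarrow>
           is_arg_min (\<lambda>v. (norm (v - xstar))\<^sup>2) (\<lambda>v. v \<in> lanczos_space A b k) (y k)"
begin

lemma x_feasible:
  assumes "lanczos_generated A b k"
  shows "x k \<in> lanczos_space A b k" and "norm (x k) \<le> \<Delta>"
proof -
  have "x k \<in> lanczos_space A b k \<and> norm (x k) \<le> \<Delta>"
  proof (cases "k \<ge> 1")
    case True
    then show ?thesis
      using run assms by (auto simp: trust_region_lanczos_def is_arg_min_def)
  next
    case False
    \<comment> \<open>The space of index 0 is the span of no directions and contains
      \<open>x 0 = 0\<close>; this case starts the induction for the sublinear rate.\<close>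
    then have "k = 0"
      by simp
    then show ?thesis
      using run \<Delta>_pos by (simp add: trust_region_lanczos_def subspace_0 subspace_lanczos_space)
  qed
  then show "x k \<in> lanczos_space A b k" "norm (x k) \<le> \<Delta>"
    by auto
qed

lemma x_optimal:
  assumes "lanczos_generated A b (Suc k)" "v \<in> lanczos_space A b (Suc k)" "norm v \<le> \<Delta>"
  shows "quad A b (x (Suc k)) \<le> quad A b v"
proof -
  have "is_arg_min (quad A b) (\<lambda>v. v \<in> lanczos_space A b (Suc k) \<and> norm v \<le> \<Delta>) (x (Suc k))"
    using run assms(1) by (simp add: trust_region_lanczos_def)
  then show ?thesis
    by (rule is_arg_min_le) (use assms in auto)
qed

lemma y_optimal:
  assumes "lanczos_generated A b (Suc k)" "v \<in> lanczos_space A b (Suc k)"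
  shows "(norm (y (Suc k) - xstar))\<^sup>2 \<le> (norm (v - xstar))\<^sup>2"
  by (rule is_arg_min_le[OF proj]) (use assms in auto)

text \<open>The projected gradient point \<open>xp\<close> is feasible and lies in the next space,
  so it competes with \<open>x (Suc k)\<close>.\<close>

lemma accelerated_step_in_space:
  assumes gen: "lanczos_generated A b (Suc k)" and w: "w \<in> lanczos_space A b k"
  obtains xp G where "G \<in> lanczos_space A b (Suc k)" "quad A b (x (Suc k)) \<le> quad A b xp"
    and "\<And>u. norm u \<le> \<Delta> \<Longrightarrow>
      quad A b xp + G \<bullet> (u - w) + (norm G)\<^sup>2 / (2 * L) + \<alpha> / 2 * (norm (u - w))\<^sup>2 \<le> quad A b u"
proof -
  have "w \<in> lanczos_space A b (Suc k)"
    using w lanczos_space_mono[of k "Suc k" A b] by auto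
  then obtain xp G where *: "xp \<in> lanczos_space A b (Suc k)" "G \<in> lanczos_space A b (Suc k)"
    "norm xp \<le> \<Delta>"
    "\<forall>u. norm u \<le> \<Delta> \<longrightarrow>
      quad A b xp + G \<bullet> (u - w) + (norm G)\<^sup>2 / (2 * L) + \<alpha> / 2 * (norm (u - w))\<^sup>2 \<le> quad A b u"
    using projected_gradient_step[OF sym upper lower L_pos \<Delta>_pos subspace_lanczos_space _
        gradient_in_lanczos_space[OF gen w]] by blast
  then show thesis
    using that x_optimal[OF gen] by blast
qed

text \<open>The potential step is carried out for \<open>xp\<close> and \<open>z\<close>; optimality
  of \<open>x (Suc k)\<close> and \<open>y (Suc k)\<close> in the next space then bounds each
  summand separately.\<close>

lemma linear_rate:
  assumes k: "k \<ge> 1" and gen: "lanczos_generated A b (Suc k)" and \<alpha>: "\<alpha> > 0" "\<alpha> \<le> L"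
  shows "(norm (y (Suc k) - xstar))\<^sup>2 + 2 * (quad A b (x (Suc k)) - quad A b xstar) / \<alpha>
    \<le> (1 - sqrt (\<alpha> / L)) * ((norm (y k - xstar))\<^sup>2 + 2 * (quad A b (x k) - quad A b xstar) / \<alpha>)"
proof -
  define q where "q = sqrt (\<alpha> / L)"
  define w where "w = (1 / (1 + q)) *\<^sub>R (x k + q *\<^sub>R y k)"
  have q: "0 < q" "q \<le> 1" "q\<^sup>2 * L = \<alpha>"
    using \<alpha> L_pos by (auto simp: q_def)
  note genk = lanczos_generated_Suc[OF gen]
  have yk: "y k \<in> lanczos_space A b k"
    using proj[OF k genk] by (simp add: is_arg_min_def)
  then have w: "w \<in> lanczos_space A b k"
    unfolding w_def using x_feasible[OF genk]
    by (intro subspace_scale subspace_add subspace_lanczos_space) auto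
  obtain xp G where G: "G \<in> lanczos_space A b (Suc k)" and xp: "quad A b (x (Suc k)) \<le> quad A b xp"
    and descent: "\<And>u. norm u \<le> \<Delta> \<Longrightarrow>
      quad A b xp + G \<bullet> (u - w) + (norm G)\<^sup>2 / (2 * L) + \<alpha> / 2 * (norm (u - w))\<^sup>2 \<le> quad A b u"
    using accelerated_step_in_space[OF gen w] by blast
  define z where "z = (1 - q) *\<^sub>R y k + q *\<^sub>R w - (q / \<alpha>) *\<^sub>R G"
  have "z \<in> lanczos_space A b (Suc k)"
    unfolding z_def using yk w G lanczos_space_mono[of k "Suc k" A b]
    by (intro subspace_diff subspace_add subspace_scale subspace_lanczos_space) auto
  then have "(norm (y (Suc k) - xstar))\<^sup>2 \<le> (norm (z - xstar))\<^sup>2"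
    by (rule y_optimal[OF gen])
  moreover have "2 * (quad A b (x (Suc k)) - quad A b xstar) / \<alpha>
      \<le> 2 * (quad A b xp - quad A b xstar) / \<alpha>"
    using xp \<alpha> by (simp add: divide_right_mono)
  moreover have "(norm (z - xstar))\<^sup>2 + 2 * (quad A b xp - quad A b xstar) / \<alpha>
    \<le> (1 - q) * ((norm (y k - xstar))\<^sup>2 + 2 * (quad A b (x k) - quad A b xstar) / \<alpha>)"
    unfolding z_def
    by (rule strongly_convex_potential_step[OF q(1,2) \<alpha>(1) q(3) w_def
          descent[OF x_feasible(2)[OF genk]] descent[OF xstar_ball]])
  ultimately show ?thesis
    unfolding q_def by linarith
qed

text \<open>The hypotheses say nothing about \<open>y 0\<close>, so \<open>0\<close>, the only point of \<open>V 0\<close>, replaces it.\<close>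

lemma convex_potential_bound:
  "lanczos_generated A b k \<Longrightarrow>
    real k * (real k + 1) / 4 * (quad A b (x k) - quad A b xstar)
      + L / 2 * (norm ((if k = 0 then 0 else y k) - xstar))\<^sup>2 \<le> L / 2 * (norm xstar)\<^sup>2"
proof (induction k)
  case (Suc k)
  note gen = Suc.prems
  note genk = lanczos_generated_Suc[OF gen]
  define yk where "yk = (if k = 0 then 0 else y k)"
  \<comment> \<open>With these weights \<open>c + a = (k + 1) (k + 2) / 4\<close>, the next value of
    \<open>c\<close>, while \<open>a^2 = (k + 1)^2 / 4\<close> stays below it.\<close>
  define c a where "c = real k * (real k + 1) / 4" and "a = (real k + 1) / 2"
  define w where "w = (1 / (c + a)) *\<^sub>R (c *\<^sub>R x k + a *\<^sub>R yk)"
  have ca: "c \<ge> 0" "a > 0" "a\<^sup>2 \<le> c + a"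
    by (auto simp: c_def a_def field_simps power2_eq_square)
  have sum: "c + a = real (Suc k) * (real (Suc k) + 1) / 4"
    by (simp add: c_def a_def field_simps)
  have yk: "yk \<in> lanczos_space A b k"
    using proj[of k] genk
    by (cases "k = 0") (auto simp: yk_def is_arg_min_def subspace_0 subspace_lanczos_space)
  then have w: "w \<in> lanczos_space A b k"
    unfolding w_def using x_feasible[OF genk]
    by (intro subspace_scale subspace_add subspace_lanczos_space) auto
  obtain xp G where G: "G \<in> lanczos_space A b (Suc k)" and xp: "quad A b (x (Suc k)) \<le> quad A b xp"
    and descent: "\<And>u. norm u \<le> \<Delta> \<Longrightarrow>
      quad A b xp + G \<bullet> (u - w) + (norm G)\<^sup>2 / (2 * L) + \<alpha> / 2 * (norm (u - w))\<^sup>2 \<le> quad A b u"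
    using accelerated_step_in_space[OF gen w] by blast
  have descent': "quad A b xp + G \<bullet> (u - w) + (norm G)\<^sup>2 / (2 * L) \<le> quad A b u"
    if "norm u \<le> \<Delta>" for u
  proof -
    have "0 \<le> \<alpha> / 2 * (norm (u - w))\<^sup>2"
      using \<alpha>_nonneg by simp
    then show ?thesis
      using descent[OF that] by linarith
  qed
  define z where "z = yk - (a / L) *\<^sub>R G"
  have "z \<in> lanczos_space A b (Suc k)"
    unfolding z_def using yk G lanczos_space_mono[of k "Suc k" A b]
    by (intro subspace_diff subspace_scale subspace_lanczos_space) auto
  then have "L / 2 * (norm (y (Suc k) - xstar))\<^sup>2 \<le> L / 2 * (norm (z - xstar))\<^sup>2"
    using L_pos by (intro mult_left_mono y_optimal[OF gen]) auto
  moreover have "(c + a) * (quad A b (x (Suc k)) - quad A b xstar)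
      \<le> (c + a) * (quad A b xp - quad A b xstar)"
    using xp ca by (intro mult_left_mono) auto
  moreover have "(c + a) * (quad A b xp - quad A b xstar) + L / 2 * (norm (z - xstar))\<^sup>2
    \<le> c * (quad A b (x k) - quad A b xstar) + L / 2 * (norm (yk - xstar))\<^sup>2"
    unfolding z_def
    by (rule convex_potential_step[OF L_pos ca w_def
          descent'[OF x_feasible(2)[OF genk]] descent'[OF xstar_ball]])
  moreover have "c * (quad A b (x k) - quad A b xstar) + L / 2 * (norm (yk - xstar))\<^sup>2
      \<le> L / 2 * (norm xstar)\<^sup>2"
    using Suc.IH[OF genk] by (simp add: c_def yk_def)
  ultimately have "(c + a) * (quad A b (x (Suc k)) - quad A b xstar)
      + L / 2 * (norm (y (Suc k) - xstar))\<^sup>2 \<le> L / 2 * (norm xstar)\<^sup>2"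
    by linarith
  then show ?case
    unfolding sum by (simp only: nat.distinct if_False)
\<comment> \<open>At \<open>k = 0\<close> the function weight vanishes and the two sides
  coincide.\<close>
qed simp

text \<open>Dropping the distance term from the potential bound leaves the function gap with weight
  \<open>k (k + 1) / 4\<close>.\<close>

lemma sublinear_rate:
  assumes k: "k \<ge> 1" and gen: "lanczos_generated A b k"
  shows "quad A b (x k) - quad A b xstar \<le> 2 * (L * (norm xstar)\<^sup>2) / real (k * (k + 1))"
proof -
  have "0 \<le> L / 2 * (norm ((if k = 0 then 0 else y k) - xstar))\<^sup>2"
    using L_pos by simp
  then have "real k * (real k + 1) / 4 * (quad A b (x k) - quad A b xstar) \<le> L / 2 * (norm xstar)\<^sup>2"
    using convex_potential_bound[OF gen] by linarith
  moreover have "real (k * (k + 1)) = real k * (real k + 1)"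
    by (simp add: algebra_simps)
  moreover have "real k * (real k + 1) > 0"
    using k by simp
  ultimately show ?thesis
    by (simp only: pos_le_divide_eq) (simp add: algebra_simps)
qed

end

section \<open>Transfer to the extended-real objective and to eigenvalues\<close>

theorem theorem8p5:
  fixes A :: "real^'n^'n"
    and b xstar :: "real^'n"
    and x y :: "nat \<Rightarrow> real^'n"
    and L \<alpha> \<Delta> :: real
    and F :: "real^'n \<Rightarrow> ereal"
  assumes "psd_matrix A"
    and "largest_eigenvalue A L"
    and "smallest_eigenvalue A \<alpha>"
    and "\<alpha> \<ge> 0"
    and "\<Delta> > 0"
    and F_def: "F = tr_objective A b \<Delta>"
    and "is_arg_min F (\<lambda>v. True) xstar"
    and "trust_region_lanczos A b \<Delta> x"
    and "\<And>k. k \<ge> 1 \<Longrightarrow> lanczos_generated A b k \<Longrightarrow>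
           is_arg_min (\<lambda>v. (norm (v - xstar))\<^sup>2) (\<lambda>v. v \<in> lanczos_space A b k) (y k)"
  shows "\<forall>k\<ge>1.
      (\<alpha> > 0 \<longrightarrow> lanczos_generated A b (k + 1) \<longrightarrow>
         ereal ((norm (y (k + 1) - xstar))\<^sup>2) + 2 * (F (x (k + 1)) - F xstar) / ereal \<alpha>
         \<le> ereal (1 - sqrt (\<alpha> / L)) *
             (ereal ((norm (y k - xstar))\<^sup>2) + 2 * (F (x k) - F xstar) / ereal \<alpha>)) \<and>
      (lanczos_generated A b k \<longrightarrow>
         F (x k) - F xstar
         \<le> 2 * (ereal (L * (norm xstar)\<^sup>2) + F 0 - F xstar) / ereal (real (k * (k + 1))))"
proof -
  have sym: "transpose A = A"
    using assms(1) by (simp add: psd_matrix_def)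
  have upper: "v \<bullet> (A *v v) \<le> L * (norm v)\<^sup>2" for v
    using rayleigh_le_largest_eigenvalue[OF sym assms(2)] .
  have lower: "\<alpha> * (norm v)\<^sup>2 \<le> v \<bullet> (A *v v)" for v
    using rayleigh_ge_smallest_eigenvalue[OF sym assms(3)] .
  have \<alpha>L: "\<alpha> \<le> L"
    using assms(2,3) by (auto simp: largest_eigenvalue_def smallest_eigenvalue_def)
  have F0: "F 0 = 0"
    using assms(5) by (simp add: F_def tr_objective_in_ball quad_def zero_ereal_def)
  have le0: "F xstar \<le> F 0"
    using assms(7) by (rule is_arg_min_le) simp
  \<comment> \<open>A minimizer outside the ball would have infinite value, above
    \<open>F 0 = 0\<close>.\<close>
  have xstar_ball: "norm xstar \<le> \<Delta>"
  proof (rule ccontr)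
    assume "\<not> norm xstar \<le> \<Delta>"
    then have "F xstar = \<infinity>"
      by (simp add: F_def tr_objective_def indicator_fun_def)
    with le0 F0 show False
      by simp
  qed
  then have Fs: "F xstar = ereal (quad A b xstar)"
    by (simp add: F_def tr_objective_in_ball)
  have fs: "quad A b xstar \<le> 0"
    using le0 by (simp add: F0 Fs zero_ereal_def)
  have run: "lanczos_run A b xstar x y \<alpha> M \<Delta>" if "M \<ge> L" "M > 0" for M
  proof
    show "v \<bullet> (A *v v) \<le> M * (norm v)\<^sup>2" for v
      using upper[of v] mult_right_mono[OF that(1), of "(norm v)\<^sup>2"] by simp
  qed (use sym lower assms xstar_ball that in auto)
  have Fx: "F (x k) = ereal (quad A b (x k))" if "lanczos_generated A b k" for k
    using lanczos_run.x_feasible(2)[OF run[of "L + 1"] that] \<alpha>L assms(4)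
    by (simp add: F_def tr_objective_in_ball)
  have two: "2 * ereal r = ereal (2 * r)" for r
    by (metis numeral_eq_ereal times_ereal.simps(1))
  show ?thesis
  proof (intro allI impI conjI)
    fix k :: nat
    assume k: "1 \<le> k" and \<alpha>: "0 < \<alpha>" and gen: "lanczos_generated A b (k + 1)"
    have genk: "lanczos_generated A b k"
      using gen lanczos_generated_Suc by simp
    have "(norm (y (k + 1) - xstar))\<^sup>2 + 2 * (quad A b (x (k + 1)) - quad A b xstar) / \<alpha>
      \<le> (1 - sqrt (\<alpha> / L)) * ((norm (y k - xstar))\<^sup>2 + 2 * (quad A b (x k) - quad A b xstar) / \<alpha>)"
      \<comment> \<open>Since \<open>0 < \<alpha> \<le> L\<close>, the constant \<open>L\<close>
        itself is admissible here.\<close>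
      using lanczos_run.linear_rate[OF run k _ \<alpha> \<alpha>L] gen \<alpha> \<alpha>L by simp
    then show "ereal ((norm (y (k + 1) - xstar))\<^sup>2) + 2 * (F (x (k + 1)) - F xstar) / ereal \<alpha>
         \<le> ereal (1 - sqrt (\<alpha> / L)) *
             (ereal ((norm (y k - xstar))\<^sup>2) + 2 * (F (x k) - F xstar) / ereal \<alpha>)"
      \<comment> \<open>All values of \<open>F\<close> are finite at generated iterates and at
        \<open>xstar\<close>, so the claim reduces to the real inequality.\<close>
      using \<alpha> by (simp add: Fx[OF gen[simplified]] Fx[OF genk] Fs two)
  next
    fix k :: nat
    assume k: "1 \<le> k" and gen: "lanczos_generated A b k"
    define K where "K = real (k * (k + 1))"
    have K: "K > 0"
      unfolding K_def of_nat_0_less_iff using k by simp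
    text \<open>The potential argument divides by its smoothness constant, while \<open>L = 0\<close> when
      \<open>A = 0\<close>; hence the limit of larger constants.\<close>
    have "quad A b (x k) - quad A b xstar \<le> 2 * (L * (norm xstar)\<^sup>2) / K"
    proof (rule tendsto_lowerbound)
      show "((\<lambda>M. 2 * (M * (norm xstar)\<^sup>2) / K) \<longlongrightarrow> 2 * (L * (norm xstar)\<^sup>2) / K) (at_right L)"
        by (intro tendsto_intros) (use K in auto)
      show "\<forall>\<^sub>F M in at_right L. quad A b (x k) - quad A b xstar \<le> 2 * (M * (norm xstar)\<^sup>2) / K"
        using \<alpha>L assms(4) lanczos_run.sublinear_rate[OF run k gen]
        by (intro eventually_at_rightI[of L "L + 1"]) (auto simp only: K_def greaterThanLessThan_iff)
    qed simp
    \<comment> \<open>The numerator grows by \<open>F 0 - F xstar\<close>, which is nonnegative,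
      with \<open>F 0 = 0\<close>.\<close>
    also have "\<dots> \<le> 2 * (L * (norm xstar)\<^sup>2 + 0 - quad A b xstar) / K"
      using fs K by (intro divide_right_mono) auto
    finally show "F (x k) - F xstar
         \<le> 2 * (ereal (L * (norm xstar)\<^sup>2) + F 0 - F xstar) / ereal (real (k * (k + 1)))"
      using K unfolding K_def[symmetric] by (simp add: Fx[OF gen] Fs F0 two)
  qed
qed

end
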